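(* Let $d\ge 2$ and let $(G_1,\dots,G_d)$ be a $d$-dimensional real-valued centered Gaussian vector whose components have unit variance, and otherwise arbitrary covariance matrix. Then, for every collection of integers $p_1,\dots,p_d\ge 1$, $$E\big[H_{p_1}(G_1)^2\cdots H_{p_d}(G_d)^2\big]\ \ge\ \prod_{i=1}^d E\big[H_{p_i}(G_i)^2\big].$$
   Context: The Hermite polynomials on the real line are defined by $H_0\equiv 1$ and $H_{k+1}(x)=xH_k(x)-H_k'(x)$ for $k\ge 0$. $E$ denotes mathematical expectation. *)

theory Defs
  imports "HOL-Probability.Probability" "HOL-Computational_Algebra.Polynomial"
begin

(* Probabilists' Hermite polynomials (monic, orthogonal for the standard Gaussian law). *)
fun Hermite :: "nat \<Rightarrow> real poly" where
  "Hermite 0 = 1"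
| "Hermite (Suc k) = [:0, 1:] * Hermite k - pderiv (Hermite k)"

(* The first disjunct is the degenerate Gaussian law, a point mass, which has no
   density with respect to Lebesgue measure. *)
definition gaussian_rv :: "'a measure \<Rightarrow> ('a \<Rightarrow> real) \<Rightarrow> bool" where
  "gaussian_rv M X \<longleftrightarrow>
     X \<in> borel_measurable M \<and>
     ((\<exists>\<mu>. AE \<omega> in M. X \<omega> = \<mu>) \<or>
      (\<exists>\<mu> \<sigma>. \<sigma> > 0 \<and> distributed M lborel X (normal_density \<mu> \<sigma>)))"

(* Joint Gaussianity of the finite family (G i), i \<in> I: since degenerate linear
   combinations are allowed, the covariance matrix may be singular. *)
definition gaussian_vector :: "'a measure \<Rightarrow> 'i set \<Rightarrow> ('i \<Rightarrow> 'a \<Rightarrow> real) \<Rightarrow> bool" where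
  "gaussian_vector M I G \<longleftrightarrow>
     (\<forall>i\<in>I. G i \<in> borel_measurable M) \<and>
     (\<forall>a :: 'i \<Rightarrow> real. gaussian_rv M (\<lambda>\<omega>. \<Sum>i\<in>I. a i * G i \<omega>))"

end

theory Submission
  imports Defs
begin

text \<open>
  Let \<open>c_v f = x_v f - D_v f\<close> be the creation operator of the coordinate \<open>G_v\<close>, where \<open>D_v\<close> is the
  derivative in the direction \<open>(E[G_v G_i])_i\<close>. Gaussian integration by parts (lemma \<open>stein\<close>) says
  that \<open>c_v\<close> and \<open>D_v\<close> are adjoint for the scalar product \<open>E[f(G) g(G)]\<close>, and for a coordinate of unit
  variance they satisfy the canonical commutation relation \<open>D_v c_v = 1 + c_v D_v\<close>. The Hermite
  polynomials are \<open>H_p(x_v) = c_v^p 1\<close>.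

  Compare the product \<open>F\<close> of the \<open>H_(p_i)(x_i)\<close> with the Wick product
  \<open>K = c_1^(p_1) ... c_d^(p_d) 1\<close>. Both have the leading monomial \<open>x_1^(p_1) ... x_d^(p_d)\<close>, and \<open>K\<close> is
  orthogonal to every polynomial of lower degree, because moving the creation operators to the other
  side differentiates that polynomial too often. So \<open>K\<close> is the orthogonal projection of \<open>F\<close> to the
  chaos of highest order, and \<open>E[F^2] \<ge> E[K^2]\<close> (lemma \<open>wick_norm_le_Hermite_norm\<close>).

  The projection loses the lower chaoses, but it leaves a vector that is built by creation
  operators alone. For these, \<open>c^n\<close> satisfies \<open>E[(c^n f)^2] \<ge> n! E[f^2]\<close> (lemma \<open>create_pow_norm_ge\<close>):
  in terms of the number operator \<open>N = c D \<ge> 0\<close>, the adjoint of \<open>c^n\<close> composed with \<open>c^n\<close> is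
  \<open>(N + 1) ... (N + n) \<ge> n!\<close>. Peeling off one coordinate after the other gives
  \<open>E[K^2] \<ge> p_1! ... p_d!\<close>, and \<open>p_i! = E[H_(p_i)(G_i)^2]\<close>.

  The covariance matrix may be singular, so the vector need not have a density. Integration by
  parts is therefore extracted from the laws of the linear combinations: their moments satisfy
  a two-step recurrence, which is differentiated with respect to the coefficients of the
  combination.
\<close>

section \<open>Moments of Gaussian variables\<close>

text \<open>
  Finiteness of all moments, unlike integrability, is inherited by products, which makes it the
  right condition for evaluating polynomials at random variables.
\<close>

definition all_moments :: "'a measure \<Rightarrow> ('a \<Rightarrow> real) \<Rightarrow> bool" where
  "all_moments M X \<longleftrightarrow> X \<in> borel_measurable M \<and> (\<forall>n. integrable M (\<lambda>\<omega>. X \<omega> ^ n))"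

lemma all_moments_measurable [measurable_dest]: "all_moments M X \<Longrightarrow> X \<in> borel_measurable M"
  by (simp add: all_moments_def)

lemma all_moments_integrable_power: "all_moments M X \<Longrightarrow> integrable M (\<lambda>\<omega>. X \<omega> ^ n)"
  by (simp add: all_moments_def)

lemma all_moments_integrable: "all_moments M X \<Longrightarrow> integrable M X"
  using all_moments_integrable_power[of M X 1] by simp

lemma integrable_power_mult_power:
  assumes "all_moments M X" "all_moments M Y"
  shows "integrable M (\<lambda>\<omega>. X \<omega> ^ m * Y \<omega> ^ n)"
proof (rule Bochner_Integration.integrable_bound)
  show "integrable M (\<lambda>\<omega>. X \<omega> ^ (2 * m) + Y \<omega> ^ (2 * n))"
    using assms by (intro Bochner_Integration.integrable_add all_moments_integrable_power)
  show "(\<lambda>\<omega>. X \<omega> ^ m * Y \<omega> ^ n) \<in> borel_measurable M"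
    using assms by measurable
  have "\<bar>x * y\<bar> \<le> x\<^sup>2 + y\<^sup>2" for x y :: real
    using sum_squares_bound[of "\<bar>x\<bar>" "\<bar>y\<bar>"] mult_nonneg_nonneg[OF abs_ge_zero abs_ge_zero, of x y]
    unfolding abs_mult power2_abs mult.assoc by linarith
  then show "AE \<omega> in M. norm (X \<omega> ^ m * Y \<omega> ^ n) \<le> norm (X \<omega> ^ (2 * m) + Y \<omega> ^ (2 * n))"
    by (simp add: power_even_eq)
qed

lemma all_moments_mult:
  assumes "all_moments M X" "all_moments M Y"
  shows "all_moments M (\<lambda>\<omega>. X \<omega> * Y \<omega>)"
  using assms integrable_power_mult_power[OF assms]
  by (auto simp: all_moments_def power_mult_distrib)

lemma all_moments_add:
  assumes "all_moments M X" "all_moments M Y"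
  shows "all_moments M (\<lambda>\<omega>. X \<omega> + Y \<omega>)"
  using assms unfolding all_moments_def
  by (auto simp: binomial_ring mult.assoc
      intro!: Bochner_Integration.integrable_sum integrable_mult_right integrable_power_mult_power assms)

lemma (in prob_space) all_moments_const: "all_moments M (\<lambda>\<omega>. c)"
  by (simp add: all_moments_def)

lemma (in prob_space) all_moments_power:
  "all_moments M X \<Longrightarrow> all_moments M (\<lambda>\<omega>. X \<omega> ^ n)"
  by (induction n) (auto intro: all_moments_mult all_moments_const)

lemma DERIV_polynomial_at_0:
  fixes c :: "nat \<Rightarrow> real"
  shows "((\<lambda>t. \<Sum>k\<le>m. c k * t ^ k) has_real_derivative (if m = 0 then 0 else c 1)) (at 0)"
proof (induction m)
  case (Suc m)
  have "((\<lambda>t. (\<Sum>k\<le>m. c k * t ^ k) + c (Suc m) * t ^ Suc m) has_real_derivative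
      (if m = 0 then 0 else c 1) + c (Suc m) * (real (Suc m) * 0 ^ m)) (at 0)"
    by (rule derivative_eq_intros Suc refl | simp)+
  then show ?case
    by (cases m) simp_all
qed simp

text \<open>
  Taking the derivative in \<open>t\<close> replaces one factor \<open>A\<close> by \<open>B\<close>. This polarisation turns identities
  for powers of all linear combinations into identities for mixed moments. The expectation
  is a polynomial in \<open>t\<close>, so no theorem on differentiation under the integral is involved.
\<close>

lemma (in prob_space) DERIV_expectation_power:
  assumes [intro]: "all_moments M A" "all_moments M B" "all_moments M C"
  shows "((\<lambda>t. expectation (\<lambda>\<omega>. C \<omega> * (A \<omega> + t * B \<omega>) ^ m)) has_real_derivative
      real m * expectation (\<lambda>\<omega>. C \<omega> * (B \<omega> * A \<omega> ^ (m - 1)))) (at 0)"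
proof -
  define c where "c k = real (m choose k) * expectation (\<lambda>\<omega>. C \<omega> * (B \<omega> ^ k * A \<omega> ^ (m - k)))" for k
  have int: "integrable M (\<lambda>\<omega>. C \<omega> * (B \<omega> ^ k * A \<omega> ^ (m - k)))" for k
    by (intro all_moments_integrable all_moments_mult all_moments_power assms)
  have "expectation (\<lambda>\<omega>. C \<omega> * (A \<omega> + t * B \<omega>) ^ m) = (\<Sum>k\<le>m. c k * t ^ k)" for t
  proof -
    have "C \<omega> * (A \<omega> + t * B \<omega>) ^ m =
        (\<Sum>k\<le>m. (real (m choose k) * t ^ k) * (C \<omega> * (B \<omega> ^ k * A \<omega> ^ (m - k))))" for \<omega>
      by (subst add.commute)
         (simp add: binomial_ring sum_distrib_left power_mult_distrib mult_ac)
    then show ?thesis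
      using int by (simp add: c_def Bochner_Integration.integral_sum mult.commute[of _ "t ^ _"] mult.assoc)
  qed
  moreover have "(if m = 0 then 0 else c 1) = real m * expectation (\<lambda>\<omega>. C \<omega> * (B \<omega> * A \<omega> ^ (m - 1)))"
    by (simp add: c_def)
  ultimately show ?thesis
    using DERIV_polynomial_at_0[of c m] by simp
qed

lemma (in prob_space) gaussian_rv_all_moments:
  assumes "gaussian_rv M X"
  shows "all_moments M X"
proof -
  have [measurable]: "X \<in> borel_measurable M"
    using assms by (simp add: gaussian_rv_def)
  consider \<mu> where "AE \<omega> in M. X \<omega> = \<mu>"
    | \<mu> \<sigma> where "\<sigma> > 0" "distributed M lborel X (normal_density \<mu> \<sigma>)"
    using assms by (auto simp: gaussian_rv_def)
  then show ?thesis
  proof cases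
    case 1
    have "integrable M (\<lambda>\<omega>. X \<omega> ^ n)" for n
      by (subst integrable_cong_AE[of _ _ "\<lambda>\<omega>. \<mu> ^ n"]) (use 1 in auto)
    then show ?thesis by (simp add: all_moments_def)
  next
    case 2
    have "integrable M (\<lambda>\<omega>. (X \<omega> - \<mu>) ^ n)" for n
      using distributed_integrable[OF 2(2), of "\<lambda>x. (x - \<mu>) ^ n"]
        integrable_normal_moment[OF 2(1), of \<mu> n] by simp
    then have "all_moments M (\<lambda>\<omega>. X \<omega> - \<mu>)"
      by (simp add: all_moments_def)
    from all_moments_add[OF this all_moments_const[of \<mu>]] show ?thesis
      by simp
  qed
qed

text \<open>
  This is the form in which the Gaussian law enters. It covers the degenerate law as well, where
  all moments of positive order vanish.
\<close>

lemma (in prob_space) centered_gaussian_moment_recurrence: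
  assumes X: "gaussian_rv M X" and mean: "expectation X = 0"
  shows "expectation (\<lambda>\<omega>. X \<omega> ^ (n + 2)) =
    (real n + 1) * expectation (\<lambda>\<omega>. X \<omega> ^ 2) * expectation (\<lambda>\<omega>. X \<omega> ^ n)"
proof -
  have [measurable]: "X \<in> borel_measurable M"
    using X by (simp add: gaussian_rv_def)
  consider \<mu> where "AE \<omega> in M. X \<omega> = \<mu>"
    | \<mu> \<sigma> where "\<sigma> > 0" "distributed M lborel X (normal_density \<mu> \<sigma>)"
    using X by (auto simp: gaussian_rv_def)
  then show ?thesis
  proof cases
    case 1
    have E: "expectation (\<lambda>\<omega>. X \<omega> ^ k) = \<mu> ^ k" for k
      by (subst integral_cong_AE[of _ _ "\<lambda>\<omega>. \<mu> ^ k"]) (use 1 in \<open>auto simp: prob_space\<close>)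
    have "\<mu> = 0"
      using mean E[of 1] by simp
    then show ?thesis by (simp only: E) simp
  next
    case 2
    have "\<mu> = 0"
      using normal_distributed_expectation[OF 2] mean by simp
    have E: "expectation (\<lambda>\<omega>. X \<omega> ^ k) = (\<integral>x. normal_density 0 \<sigma> x * (x - 0) ^ k \<partial>lborel)" for k
      using distributed_integral[OF 2(2), of "\<lambda>x. x ^ k"] \<open>\<mu> = 0\<close> by simp
    have even: "expectation (\<lambda>\<omega>. X \<omega> ^ (2 * k)) = fact (2 * k) / ((2 / \<sigma>\<^sup>2) ^ k * fact k)" for k
      unfolding E using integral_normal_moment_even[OF 2(1), of 0 k] .
    have odd: "expectation (\<lambda>\<omega>. X \<omega> ^ (2 * k + 1)) = 0" for k
      unfolding E using integral_normal_moment_odd[OF 2(1), of 0 k] .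
    show ?thesis
    proof (cases "even n")
      case True
      then obtain k where n: "n = 2 * k" by blast
      have "expectation (\<lambda>\<omega>. X \<omega> ^ (2 * Suc k)) =
          (real (2 * k) + 1) * expectation (\<lambda>\<omega>. X \<omega> ^ (2 * 1)) * expectation (\<lambda>\<omega>. X \<omega> ^ (2 * k))"
        unfolding even using \<open>\<sigma> > 0\<close>
        by (simp add: divide_simps del: of_nat_Suc) (simp add: algebra_simps)
      then show ?thesis
        by (simp add: n)
    next
      case False
      then obtain k where n: "n = 2 * k + 1" by (blast elim: oddE)
      show ?thesis
        using odd[of k] odd[of "Suc k"] by (simp add: n)
    qed
  qed
qed

section \<open>Polynomial functions and their directional derivatives\<close>

text \<open>
  Polynomials in the coordinates from \<open>I\<close>, of degree strictly below the index. With a strict bound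
  the index \<open>0\<close> means the zero function, and differentiation lowers the index without
  a special case for constants.
\<close>

inductive polyfun_lt :: "'i set \<Rightarrow> nat \<Rightarrow> (('i \<Rightarrow> real) \<Rightarrow> real) \<Rightarrow> bool" for I where
  zero: "polyfun_lt I 0 (\<lambda>x. 0)"
| const: "polyfun_lt I (Suc 0) (\<lambda>x. c)"
| times_var: "i \<in> I \<Longrightarrow> polyfun_lt I n f \<Longrightarrow> polyfun_lt I (Suc n) (\<lambda>x. x i * f x)"
| add: "polyfun_lt I n f \<Longrightarrow> polyfun_lt I n g \<Longrightarrow> polyfun_lt I n (\<lambda>x. f x + g x)"
| lift_Suc: "polyfun_lt I n f \<Longrightarrow> polyfun_lt I (Suc n) f"

lemma polyfun_lt_mono: "polyfun_lt I m f \<Longrightarrow> m \<le> n \<Longrightarrow> polyfun_lt I n f"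
  by (rotate_tac, induction rule: dec_induct) (auto intro: lift_Suc)

lemma polyfun_lt_zero: "polyfun_lt I n (\<lambda>x. 0)"
  by (rule polyfun_lt_mono[OF polyfun_lt.zero]) simp

lemma polyfun_lt_0D: "polyfun_lt I 0 f \<Longrightarrow> f = (\<lambda>x. 0)"
  by (induction "0::nat" f rule: polyfun_lt.induct) auto

lemma polyfun_lt_scale: "polyfun_lt I n f \<Longrightarrow> polyfun_lt I n (\<lambda>x. c * f x)"
proof (induction rule: polyfun_lt.induct)
  case (times_var i n f)
  then show ?case
    using polyfun_lt.times_var[of i I n "\<lambda>x. c * f x"] by (simp add: mult_ac)
qed (auto simp: distrib_left intro: polyfun_lt.intros)

lemma polyfun_lt_diff:
  "polyfun_lt I n f \<Longrightarrow> polyfun_lt I n g \<Longrightarrow> polyfun_lt I n (\<lambda>x. f x - g x)"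
  using add[of I n f "\<lambda>x. (-1) * g x"] polyfun_lt_scale[of I n g "-1"] by simp

lemma polyfun_lt_mult:
  assumes "polyfun_lt I m f" "polyfun_lt I n g"
  shows "polyfun_lt I (m + n) (\<lambda>x. f x * g x)"
  using assms(1)
proof (induction rule: polyfun_lt.induct)
  case zero
  show ?case by (simp add: polyfun_lt_zero)
next
  case (const c)
  show ?case
    using polyfun_lt_scale[OF assms(2)] by (simp add: lift_Suc)
next
  case (times_var i n f)
  then show ?case
    using polyfun_lt.times_var[of i I] by (simp add: mult.assoc)
qed (auto simp: distrib_right intro: polyfun_lt.intros)

text \<open>
  Polynomials are functions, with the analytic derivative, so that equal functions have
  equal derivatives whatever expressions represent them.
\<close>

definition dir_deriv :: "('i \<Rightarrow> real) \<Rightarrow> (('i \<Rightarrow> real) \<Rightarrow> real) \<Rightarrow> ('i \<Rightarrow> real) \<Rightarrow> real" where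
  "dir_deriv h f x = deriv (\<lambda>t. f (\<lambda>i. x i + t * h i)) 0"

lemma dir_derivI:
  "(\<And>x. ((\<lambda>t. f (\<lambda>i. x i + t * h i)) has_real_derivative f' x) (at 0)) \<Longrightarrow> dir_deriv h f = f'"
  unfolding dir_deriv_def by (rule ext, rule DERIV_imp_deriv) blast

lemma polyfun_DERIV:
  "polyfun_lt I n f \<Longrightarrow>
    ((\<lambda>t. f (\<lambda>i. x i + t * h i)) has_real_derivative dir_deriv h f x) (at 0)"
proof (induction rule: polyfun_lt.induct)
  case (times_var i n f)
  have "((\<lambda>t. (x i + t * h i) * f (\<lambda>i. x i + t * h i)) has_real_derivative
      h i * f x + x i * dir_deriv h f x) (at 0)"
    by (auto intro!: derivative_eq_intros times_var.IH)
  from this[THEN DERIV_imp_deriv] this show ?case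
    by (simp add: dir_deriv_def)
next
  case (add n f g)
  then show ?case
    unfolding dir_deriv_def
    by (subst DERIV_deriv_iff_real_differentiable, intro derivative_intros)
       (auto simp: real_differentiable_def)
qed (auto simp: dir_deriv_def)

lemma dir_deriv_const [simp]: "dir_deriv h (\<lambda>x. c) = (\<lambda>x. 0)"
  by (rule dir_derivI) simp

lemma dir_deriv_times_var:
  assumes "polyfun_lt I n f"
  shows "dir_deriv h (\<lambda>x. x i * f x) = (\<lambda>x. h i * f x + x i * dir_deriv h f x)"
  by (rule dir_derivI) (auto intro!: derivative_eq_intros polyfun_DERIV[OF assms])

lemma dir_deriv_add:
  assumes "polyfun_lt I m f" "polyfun_lt I n g"
  shows "dir_deriv h (\<lambda>x. f x + g x) = (\<lambda>x. dir_deriv h f x + dir_deriv h g x)"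
  by (rule dir_derivI) (auto intro!: derivative_eq_intros polyfun_DERIV[OF assms(1)] polyfun_DERIV[OF assms(2)])

lemma dir_deriv_diff:
  assumes "polyfun_lt I m f" "polyfun_lt I n g"
  shows "dir_deriv h (\<lambda>x. f x - g x) = (\<lambda>x. dir_deriv h f x - dir_deriv h g x)"
  by (rule dir_derivI) (auto intro!: derivative_eq_intros polyfun_DERIV[OF assms(1)] polyfun_DERIV[OF assms(2)])

lemma dir_deriv_mult:
  assumes "polyfun_lt I m f" "polyfun_lt I n g"
  shows "dir_deriv h (\<lambda>x. f x * g x) = (\<lambda>x. dir_deriv h f x * g x + f x * dir_deriv h g x)"
  by (rule dir_derivI) (auto intro!: derivative_eq_intros polyfun_DERIV[OF assms(1)] polyfun_DERIV[OF assms(2)])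

lemma polyfun_lt_dir_deriv:
  "polyfun_lt I n f \<Longrightarrow> polyfun_lt I (n - 1) (dir_deriv h f)"
proof (induction rule: polyfun_lt.induct)
  case (times_var i n f)
  have "polyfun_lt I n (\<lambda>x. x i * dir_deriv h f x)"
  proof (cases n)
    case 0
    then show ?thesis
      using polyfun_lt_0D times_var.hyps(2) polyfun_lt.zero by fastforce
  next
    case (Suc m)
    then show ?thesis
      using polyfun_lt.times_var[OF times_var.hyps(1) times_var.IH] by simp
  qed
  then show ?case
    using times_var by (auto simp: dir_deriv_times_var[OF times_var.hyps(2)]
        intro!: polyfun_lt.add polyfun_lt_scale)
next
  case (add n f g)
  then show ?case
    by (simp add: dir_deriv_add[OF add.hyps] polyfun_lt.add)
next
  case (lift_Suc n f)
  then show ?case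
    using polyfun_lt_mono[OF lift_Suc.IH] by simp
qed (auto simp: polyfun_lt_zero)

definition polyfun :: "'i set \<Rightarrow> (('i \<Rightarrow> real) \<Rightarrow> real) \<Rightarrow> bool" where
  "polyfun I f \<longleftrightarrow> (\<exists>n. polyfun_lt I n f)"

lemma polyfunI: "polyfun_lt I n f \<Longrightarrow> polyfun I f"
  by (auto simp: polyfun_def)

lemma polyfun_const [intro]: "polyfun I (\<lambda>x. c)"
  by (rule polyfunI[OF polyfun_lt.const])

lemma polyfun_mult [intro]: "polyfun I f \<Longrightarrow> polyfun I g \<Longrightarrow> polyfun I (\<lambda>x. f x * g x)"
  unfolding polyfun_def using polyfun_lt_mult by blast

lemma polyfun_var [intro]: "i \<in> I \<Longrightarrow> polyfun I (\<lambda>x. x i)"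
  using polyfunI[OF polyfun_lt.times_var[OF _ polyfun_lt.const[of I 1]]] by simp

lemma polyfun_add [intro]:
  assumes "polyfun I f" "polyfun I g"
  shows "polyfun I (\<lambda>x. f x + g x)"
proof -
  obtain m n where "polyfun_lt I m f" "polyfun_lt I n g"
    using assms by (auto simp: polyfun_def)
  then have "polyfun_lt I (max m n) f" "polyfun_lt I (max m n) g"
    by (auto elim: polyfun_lt_mono)
  then show ?thesis
    by (blast intro: polyfunI polyfun_lt.add)
qed

lemma polyfun_diff [intro]:
  "polyfun I f \<Longrightarrow> polyfun I g \<Longrightarrow> polyfun I (\<lambda>x. f x - g x)"
  using polyfun_add[of I f "\<lambda>x. (-1) * g x"] polyfun_mult[of I "\<lambda>x. -1" g] by auto

lemma polyfun_power [intro]: "polyfun I f \<Longrightarrow> polyfun I (\<lambda>x. f x ^ n)"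
  by (induction n) auto

lemma polyfun_sum [intro]:
  "finite A \<Longrightarrow> (\<And>a. a \<in> A \<Longrightarrow> polyfun I (f a)) \<Longrightarrow> polyfun I (\<lambda>x. \<Sum>a\<in>A. f a x)"
  by (induction A rule: finite_induct) auto

lemma polyfun_dir_deriv [intro]: "polyfun I f \<Longrightarrow> polyfun I (dir_deriv h f)"
  unfolding polyfun_def using polyfun_lt_dir_deriv by blast

definition linform :: "'i set \<Rightarrow> ('i \<Rightarrow> real) \<Rightarrow> ('i \<Rightarrow> real) \<Rightarrow> real" where
  "linform I \<theta> x = (\<Sum>i\<in>I. \<theta> i * x i)"

lemma linform_update:
  assumes "finite I" "v \<in> I"
  shows "linform I (\<theta>(v := \<theta> v + t)) x = linform I \<theta> x + t * x v"
  using assms by (simp add: linform_def sum.remove distrib_right)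

lemma polyfun_linform [intro]: "finite I \<Longrightarrow> polyfun I (linform I \<theta>)"
  unfolding linform_def by (intro polyfun_sum polyfun_mult) auto

section \<open>Gaussian integration by parts\<close>

locale centered_gaussian_vector = prob_space M for M :: "'a measure" +
  fixes I :: "'i set" and G :: "'i \<Rightarrow> 'a \<Rightarrow> real"
  assumes finite_I [simp]: "finite I"
    and gaussian: "gaussian_vector M I G"
    and centered: "i \<in> I \<Longrightarrow> expectation (G i) = 0"
begin

definition Exp :: "(('i \<Rightarrow> real) \<Rightarrow> real) \<Rightarrow> real" where
  "Exp f = expectation (\<lambda>\<omega>. f (\<lambda>i. G i \<omega>))"

definition cov :: "'i \<Rightarrow> 'i \<Rightarrow> real" where
  "cov v i = Exp (\<lambda>x. x v * x i)"

lemma gaussian_rv_linform: "gaussian_rv M (\<lambda>\<omega>. linform I \<theta> (\<lambda>i. G i \<omega>))"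
  using gaussian by (simp add: gaussian_vector_def linform_def)

lemma all_moments_coord:
  assumes "i \<in> I"
  shows "all_moments M (G i)"
proof -
  have "linform I (\<lambda>j. if j = i then 1 else 0) = (\<lambda>x. x i)"
    using assms by (simp add: linform_def fun_eq_iff if_distrib[of "\<lambda>c. c * _"] cong: if_cong)
  then show ?thesis
    using gaussian_rv_all_moments[OF gaussian_rv_linform, of "\<lambda>j. if j = i then 1 else 0"] by simp
qed

lemma all_moments_polyfun:
  assumes "polyfun I f"
  shows "all_moments M (\<lambda>\<omega>. f (\<lambda>i. G i \<omega>))"
proof -
  have "polyfun_lt I n g \<Longrightarrow> all_moments M (\<lambda>\<omega>. g (\<lambda>i. G i \<omega>))" for n g
    by (induction rule: polyfun_lt.induct)
       (auto intro: all_moments_const all_moments_mult all_moments_add all_moments_coord)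
  then show ?thesis
    using assms by (auto simp: polyfun_def)
qed

lemma integrable_polyfun [intro]: "polyfun I f \<Longrightarrow> integrable M (\<lambda>\<omega>. f (\<lambda>i. G i \<omega>))"
  by (intro all_moments_integrable all_moments_polyfun)

lemma Exp_const [simp]: "Exp (\<lambda>x. c) = c"
  by (simp add: Exp_def prob_space)

lemma Exp_add: "polyfun I f \<Longrightarrow> polyfun I g \<Longrightarrow> Exp (\<lambda>x. f x + g x) = Exp f + Exp g"
  unfolding Exp_def by (intro Bochner_Integration.integral_add) auto

lemma Exp_diff: "polyfun I f \<Longrightarrow> polyfun I g \<Longrightarrow> Exp (\<lambda>x. f x - g x) = Exp f - Exp g"
  unfolding Exp_def by (intro Bochner_Integration.integral_diff) auto

lemma Exp_scale: "Exp (\<lambda>x. c * f x) = c * Exp f"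
  unfolding Exp_def by simp

lemma Exp_square_nonneg: "Exp (\<lambda>x. f x * f x) \<ge> 0"
  unfolding Exp_def by (rule Bochner_Integration.integral_nonneg) simp

lemma Exp_sum:
  "finite A \<Longrightarrow> (\<And>a. a \<in> A \<Longrightarrow> polyfun I (f a)) \<Longrightarrow> Exp (\<lambda>x. \<Sum>a\<in>A. f a x) = (\<Sum>a\<in>A. Exp (f a))"
  unfolding Exp_def by (intro Bochner_Integration.integral_sum) auto

lemma Exp_coord: "i \<in> I \<Longrightarrow> Exp (\<lambda>x. x i) = 0"
  by (simp add: Exp_def centered)

lemma Exp_linform: "Exp (linform I \<theta>) = 0"
proof -
  have "Exp (linform I \<theta>) = (\<Sum>i\<in>I. Exp (\<lambda>x. \<theta> i * x i))"
    unfolding linform_def by (rule Exp_sum) auto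
  then show ?thesis
    by (simp add: Exp_scale Exp_coord)
qed

lemma Exp_coord_linform: "v \<in> I \<Longrightarrow> Exp (\<lambda>x. x v * linform I \<theta> x) = linform I \<theta> (cov v)"
proof -
  assume "v \<in> I"
  have "Exp (\<lambda>x. x v * linform I \<theta> x) = Exp (\<lambda>x. \<Sum>i\<in>I. \<theta> i * (x v * x i))"
    by (simp add: linform_def sum_distrib_left mult_ac)
  also have "\<dots> = (\<Sum>i\<in>I. Exp (\<lambda>x. \<theta> i * (x v * x i)))"
    using \<open>v \<in> I\<close> by (intro Exp_sum polyfun_mult polyfun_var polyfun_const) simp_all
  finally show ?thesis
    by (simp add: Exp_scale cov_def linform_def)
qed

lemma Exp_linform_power_Suc_Suc:
  "Exp (\<lambda>x. linform I \<theta> x ^ (n + 2)) =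
    (real n + 1) * Exp (\<lambda>x. linform I \<theta> x ^ 2) * Exp (\<lambda>x. linform I \<theta> x ^ n)"
  using centered_gaussian_moment_recurrence[OF gaussian_rv_linform] Exp_linform
  by (simp only: Exp_def)

lemma DERIV_Exp_linform_power:
  assumes "polyfun I g" "v \<in> I"
  shows "((\<lambda>t. Exp (\<lambda>x. g x * linform I (\<theta>(v := \<theta> v + t)) x ^ m)) has_real_derivative
    real m * Exp (\<lambda>x. g x * (x v * linform I \<theta> x ^ (m - 1)))) (at 0)"
  unfolding Exp_def linform_update[OF finite_I assms(2)]
  by (rule DERIV_expectation_power; rule all_moments_polyfun) (use assms in auto)

text \<open>
  Let \<open>L\<close> be the linear form with coefficients \<open>\<theta>\<close>, \<open>m k = E[L^k]\<close>, \<open>s k = E[x_v L^k]\<close>, \<open>r = s 1\<close>.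
  Differentiating the recurrence \<open>m (n + 1) = n m 2 m (n - 1)\<close> in the coefficient of \<open>x_v\<close> gives
  \<open>(n + 1) s n = n (2 r m (n - 1) + (n - 1) m 2 s (n - 2))\<close>, from which the claim
  \<open>s n = n r m (n - 1)\<close> follows by strong induction.
\<close>

lemma stein_linform_power:
  assumes v: "v \<in> I"
  shows "Exp (\<lambda>x. x v * linform I \<theta> x ^ n) =
    real n * linform I \<theta> (cov v) * Exp (\<lambda>x. linform I \<theta> x ^ (n - 1))"
proof (induction n rule: less_induct)
  case (less n)
  define L where "L = linform I \<theta>"
  define m where "m k = Exp (\<lambda>x. L x ^ k)" for k
  define s where "s k = Exp (\<lambda>x. x v * L x ^ k)" for k
  define r where "r = linform I \<theta> (cov v)"
  have IH: "s k = real k * r * m (k - 1)" if "k < n" for k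
    using less.IH[OF that] by (simp add: s_def m_def r_def L_def)
  have m_rec: "m (k + 2) = (real k + 1) * m 2 * m k" for k
    using Exp_linform_power_Suc_Suc[of \<theta> k] by (simp only: m_def L_def)
  have r: "s 1 = r"
    using Exp_coord_linform[OF v, of \<theta>] by (simp add: s_def r_def L_def)
  have "s n = real n * r * m (n - 1)"
  proof (cases "n \<le> 1")
    case True
    then consider "n = 0" | "n = 1" by linarith
    then show ?thesis
    proof cases
      case 1
      then show ?thesis using Exp_coord[OF v] by (simp add: s_def)
    next
      case 2
      then show ?thesis using r by (simp add: m_def)
    qed
  next
    case False
    then obtain k where n: "n = Suc (Suc k)" by (metis One_nat_def not0_implies_Suc not_less_eq_eq le0 Suc_le_mono)
    have DERIV: "((\<lambda>t. Exp (\<lambda>x. linform I (\<theta>(v := \<theta> v + t)) x ^ j)) has_real_derivative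
        real j * s (j - 1)) (at 0)" for j
      using DERIV_Exp_linform_power[of "\<lambda>x. 1" v \<theta> j] v by (auto simp: s_def L_def)
    have "((\<lambda>t. (real (Suc k) + 1) * Exp (\<lambda>x. linform I (\<theta>(v := \<theta> v + t)) x ^ 2) *
          Exp (\<lambda>x. linform I (\<theta>(v := \<theta> v + t)) x ^ Suc k)) has_real_derivative
        (real (Suc k) + 1) * (2 * r * m (Suc k) + m 2 * (real (Suc k) * s k))) (at 0)"
      using DERIV[of 2] DERIV[of "Suc k"] r
      by (auto intro!: derivative_eq_intros simp: m_def L_def algebra_simps)
    \<comment> \<open>the derivatives at \<open>0\<close> of both sides of the moment recurrence agree\<close>
    from DERIV_unique[OF DERIV[of "Suc k + 2", unfolded Exp_linform_power_Suc_Suc] this]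
    have "real (k + 3) * s n = (real k + 2) * (2 * r * m (Suc k) + (real k + 1) * (m 2 * s k))"
      by (simp add: n algebra_simps)
    also have "m 2 * s k = real k * r * (m 2 * m (k - 1))"
      using IH[of k] n by simp
    also have "(real k) * r * (m 2 * m (k - 1)) = r * m (Suc k)"
    proof (cases k)
      case 0
      then show ?thesis using Exp_linform[of \<theta>] by (simp add: m_def L_def)
    next
      case (Suc j)
      then show ?thesis using m_rec[of j] by (simp add: algebra_simps)
    qed
    also have "(real k + 2) * (2 * r * m (Suc k) + (real k + 1) * (r * m (Suc k))) =
        real (k + 3) * (real n * r * m (n - 1))"
      by (simp add: n algebra_simps)
    finally show ?thesis
      by simp
  qed
  then show ?case
    by (simp add: s_def m_def r_def L_def)
qed

text \<open>
  Integration by parts for \<open>f L^n\<close>, with \<open>L\<close> an arbitrary linear form. The powers of \<open>L\<close> are carried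
  along for the induction on \<open>f\<close>: differentiating the statement for \<open>f L^(n + 1)\<close> in the coefficient
  of \<open>x_i\<close> gives the statement for \<open>x_i f L^n\<close>.
\<close>

lemma stein_times_linform_power:
  assumes v: "v \<in> I" and f: "polyfun_lt I k f"
  shows "Exp (\<lambda>x. (x v * f x) * linform I \<theta> x ^ n) =
    Exp (\<lambda>x. dir_deriv (cov v) f x * linform I \<theta> x ^ n) +
    real n * (linform I \<theta> (cov v) * Exp (\<lambda>x. f x * linform I \<theta> x ^ (n - 1)))"
  using f
proof (induction arbitrary: \<theta> n rule: polyfun_lt.induct)
  case zero
  show ?case by simp
next
  case (const c)
  have "Exp (\<lambda>x. x v * c * linform I \<theta> x ^ n) = c * Exp (\<lambda>x. x v * linform I \<theta> x ^ n)"
    by (simp add: Exp_scale[symmetric] mult_ac)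
  then show ?case
    by (simp add: stein_linform_power[OF v] Exp_scale)
next
  case (lift_Suc n f)
  show ?case by (rule lift_Suc.IH)
next
  case (add k f g)
  have fg: "polyfun I f" "polyfun I g"
    using add.hyps by (auto intro: polyfunI)
  note poly = polyfun_mult[OF fg(1)] polyfun_mult[OF fg(2)] polyfun_var[OF v]
    polyfun_power[OF polyfun_linform[OF finite_I]] polyfun_dir_deriv fg polyfun_mult
  show ?case
    using add.IH(1)[of \<theta> n] add.IH(2)[of \<theta> n]
    by (simp add: dir_deriv_add[OF add.hyps] distrib_left distrib_right Exp_add poly)
next
  case (times_var i k f)
  have f: "polyfun I f"
    using times_var.hyps by (auto intro: polyfunI)
  note poly = f polyfun_var[OF v] polyfun_var[OF times_var.hyps(1)]
    polyfun_power[OF polyfun_linform[OF finite_I]] polyfun_dir_deriv[OF f] polyfun_mult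
  define h where "h = cov v"
  define L where "L = linform I \<theta>"
  note D = DERIV_Exp_linform_power[OF _ times_var.hyps(1), of _ \<theta>, folded L_def]
  have lhs: "((\<lambda>t. Exp (\<lambda>x. (x v * f x) * linform I (\<theta>(i := \<theta> i + t)) x ^ Suc n)) has_real_derivative
      real (Suc n) * Exp (\<lambda>x. (x v * f x) * (x i * L x ^ n))) (at 0)"
    using D[OF polyfun_mult[OF polyfun_var[OF v] f], of "Suc n"] by simp
  have "((\<lambda>t. Exp (\<lambda>x. dir_deriv h f x * linform I (\<theta>(i := \<theta> i + t)) x ^ Suc n) +
       real (Suc n) * (linform I (\<theta>(i := \<theta> i + t)) h *
         Exp (\<lambda>x. f x * linform I (\<theta>(i := \<theta> i + t)) x ^ n))) has_real_derivative
      real (Suc n) * Exp (\<lambda>x. dir_deriv h f x * (x i * L x ^ n)) +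
      real (Suc n) * (h i * Exp (\<lambda>x. f x * L x ^ n) +
        (real n * Exp (\<lambda>x. f x * (x i * L x ^ (n - 1)))) * L h)) (at 0)"
    using D[OF polyfun_dir_deriv[OF f, of h], of "Suc n"] D[OF f, of n]
    unfolding linform_update[OF finite_I times_var.hyps(1)]
    by (auto intro!: derivative_eq_intros simp: L_def)
  from DERIV_unique[OF this lhs[unfolded times_var.IH, folded h_def, unfolded diff_Suc_1]]
  have "real (Suc n) * Exp (\<lambda>x. (x v * f x) * (x i * L x ^ n)) =
      real (Suc n) * (Exp (\<lambda>x. dir_deriv h f x * (x i * L x ^ n)) +
        (h i * Exp (\<lambda>x. f x * L x ^ n) + real n * (L h * Exp (\<lambda>x. f x * (x i * L x ^ (n - 1))))))"
    by (simp only: distrib_left mult_ac)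
  then have *: "Exp (\<lambda>x. (x v * f x) * (x i * L x ^ n)) =
      Exp (\<lambda>x. dir_deriv h f x * (x i * L x ^ n)) +
        (h i * Exp (\<lambda>x. f x * L x ^ n) + real n * (L h * Exp (\<lambda>x. f x * (x i * L x ^ (n - 1)))))"
    by (simp only: mult_cancel_left of_nat_eq_0_iff nat.distinct simp_thms)
  have "Exp (\<lambda>x. dir_deriv h (\<lambda>x. x i * f x) x * L x ^ n) =
      Exp (\<lambda>x. h i * (f x * L x ^ n) + dir_deriv h f x * (x i * L x ^ n))"
    by (simp add: dir_deriv_times_var[OF times_var.hyps(2)] algebra_simps)
  also have "\<dots> = h i * Exp (\<lambda>x. f x * L x ^ n) + Exp (\<lambda>x. dir_deriv h f x * (x i * L x ^ n))"
    by (subst Exp_add) (auto simp: Exp_scale L_def intro!: poly polyfun_const)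
  finally show ?case
    using * by (simp add: h_def L_def mult_ac)
qed

lemma stein:
  assumes "v \<in> I" "polyfun I f"
  shows "Exp (\<lambda>x. x v * f x) = Exp (dir_deriv (cov v) f)"
  using assms stein_times_linform_power[of v _ f _ 0] by (auto simp: polyfun_def)

section \<open>Creation operators and Wick products\<close>

definition create :: "'i \<Rightarrow> (('i \<Rightarrow> real) \<Rightarrow> real) \<Rightarrow> ('i \<Rightarrow> real) \<Rightarrow> real" where
  "create v f = (\<lambda>x. x v * f x - dir_deriv (cov v) f x)"

lemma polyfun_create [intro]: "v \<in> I \<Longrightarrow> polyfun I f \<Longrightarrow> polyfun I (create v f)"
  unfolding create_def by (intro polyfun_diff polyfun_mult polyfun_var polyfun_dir_deriv)

lemma polyfun_create_pow [intro]: "v \<in> I \<Longrightarrow> polyfun I f \<Longrightarrow> polyfun I ((create v ^^ n) f)"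
  by (induction n) auto

text \<open>
  Adjointness of creation and differentiation: integration by parts for \<open>f g\<close>, with the product rule.
\<close>

lemma Exp_create_mult:
  assumes "v \<in> I" "polyfun I f" "polyfun I g"
  shows "Exp (\<lambda>x. create v f x * g x) = Exp (\<lambda>x. f x * dir_deriv (cov v) g x)"
proof -
  let ?a = "dir_deriv (cov v)"
  obtain m n where "polyfun_lt I m f" "polyfun_lt I n g"
    using assms by (auto simp: polyfun_def)
  note D = dir_deriv_mult[OF this]
  have "Exp (\<lambda>x. create v f x * g x) = Exp (\<lambda>x. x v * (f x * g x) - ?a f x * g x)"
    by (simp add: create_def algebra_simps)
  also have "\<dots> = Exp (\<lambda>x. x v * (f x * g x)) - Exp (\<lambda>x. ?a f x * g x)"
    using assms by (intro Exp_diff polyfun_mult polyfun_var polyfun_dir_deriv)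
  also have "Exp (\<lambda>x. x v * (f x * g x)) = Exp (\<lambda>x. ?a f x * g x + f x * ?a g x)"
    using assms by (simp add: stein polyfun_mult D)
  also have "\<dots> = Exp (\<lambda>x. ?a f x * g x) + Exp (\<lambda>x. f x * ?a g x)"
    using assms by (intro Exp_add polyfun_mult polyfun_dir_deriv)
  finally show ?thesis by simp
qed

lemma create_add_scale:
  assumes "polyfun I f" "polyfun I g"
  shows "create v (\<lambda>x. c * f x + g x) = (\<lambda>x. c * create v f x + create v g x)"
proof -
  obtain m n where fg: "polyfun_lt I m f" "polyfun_lt I n g"
    using assms by (auto simp: polyfun_def)
  show ?thesis
    using dir_deriv_add[OF polyfun_lt_scale[OF fg(1), of c] fg(2)]
      dir_deriv_mult[OF polyfun_lt.const[of I c] fg(1)]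
    by (auto simp: create_def algebra_simps)
qed

lemma create_pow_Suc:
  "(create v ^^ Suc n) f = (\<lambda>x. x v * (create v ^^ n) f x - dir_deriv (cov v) ((create v ^^ n) f) x)"
  by (simp add: create_def[of v "(create v ^^ n) f"])

lemma create_pow_zero: "(create v ^^ n) (\<lambda>x. 0) = (\<lambda>x. 0)"
  by (induction n) (simp_all add: create_def)

text \<open>
  This is the projection of the product of the \<open>x_i^(p i)\<close> to the chaos of highest order. The
  creation operators commute, so the order of the list is immaterial.
\<close>

fun wick :: "('i \<Rightarrow> nat) \<Rightarrow> 'i list \<Rightarrow> ('i \<Rightarrow> real) \<Rightarrow> real" where
  "wick p [] = (\<lambda>x. 1)"
| "wick p (i # is) = (create i ^^ p i) (wick p is)"

lemma polyfun_wick: "set is \<subseteq> I \<Longrightarrow> polyfun I (wick p is)"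
  by (induction "is") auto

text \<open>
  Each creation operator becomes a derivative of \<open>g\<close> on the other side, and so raises by one the degree
  up to which orthogonality holds.
\<close>

lemma create_pow_orthogonal:
  assumes "v \<in> I" "polyfun I K"
    and "\<And>g. polyfun_lt I m g \<Longrightarrow> Exp (\<lambda>x. K x * g x) = 0"
    and "polyfun_lt I (m + n) g"
  shows "Exp (\<lambda>x. (create v ^^ n) K x * g x) = 0"
  using assms(4)
proof (induction n arbitrary: g)
  case (Suc n)
  have "polyfun_lt I (m + n) (dir_deriv (cov v) g)"
    using polyfun_lt_dir_deriv[OF Suc.prems] by simp
  then show ?case
    using Suc assms(1,2) by (simp add: Exp_create_mult polyfun_create_pow polyfunI[OF Suc.prems])
qed (use assms(3) in simp)

lemma wick_orthogonal:
  "set is \<subseteq> I \<Longrightarrow> polyfun_lt I (sum_list (map p is)) g \<Longrightarrow> Exp (\<lambda>x. wick p is x * g x) = 0"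
proof (induction "is" arbitrary: g)
  case Nil
  then show ?case using polyfun_lt_0D by fastforce
next
  case (Cons i "is")
  then show ?case
    using create_pow_orthogonal[of i "wick p is" "sum_list (map p is)" "p i" g]
    by (simp add: polyfun_wick add.commute)
qed

section \<open>Comparison of Hermite products with Wick products\<close>

lemma degree_Hermite_le: "degree (Hermite n) \<le> n"
proof (induction n)
  case (Suc n)
  have "degree ([:0, 1:] * Hermite n) \<le> Suc n"
    using degree_mult_le[of "[:0, 1:]" "Hermite n"] Suc by simp
  moreover have "degree (pderiv (Hermite n)) \<le> Suc n"
    using Suc by (simp add: degree_pderiv)
  ultimately show ?case
    by (simp add: degree_diff_le)
qed simp

lemma polyfun_lt_poly_mult:
  assumes "v \<in> I" "polyfun_lt I (Suc m) f"
  shows "polyfun_lt I (Suc (m + degree q)) (\<lambda>x. poly q (x v) * f x)"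
proof (induction q)
  case 0
  then show ?case by (simp add: polyfun_lt_zero)
next
  case (pCons a q)
  show ?case
  proof (cases "q = 0")
    case True
    then show ?thesis
      using polyfun_lt_scale[OF assms(2), of a] by simp
  next
    case False
    have "polyfun_lt I (Suc (m + Suc (degree q))) (\<lambda>x. a * f x)"
      by (rule polyfun_lt_mono[OF polyfun_lt_scale[OF assms(2)]]) simp
    moreover have "polyfun_lt I (Suc (m + Suc (degree q))) (\<lambda>x. x v * (poly q (x v) * f x))"
      using polyfun_lt.times_var[OF assms(1) pCons.IH] by simp
    ultimately show ?thesis
      using False by (auto simp: distrib_right mult.assoc dest: polyfun_lt.add)
  qed
qed

text \<open>
  Both \<open>H_(n + 1) = x H_n - H_n'\<close> and \<open>c_v = x_v - D_v\<close> multiply by \<open>x_v\<close> up to terms of lower degree,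
  so equality of the leading parts of \<open>F\<close> and \<open>K\<close> persists.
\<close>

lemma Hermite_mult_create_pow:
  assumes v: "v \<in> I" and F: "polyfun_lt I (Suc m) F" and FK: "polyfun_lt I m (\<lambda>x. F x - K x)"
  shows "polyfun_lt I (m + n) (\<lambda>x. poly (Hermite n) (x v) * F x - (create v ^^ n) K x)"
proof (induction n)
  case 0
  show ?case using FK by simp
next
  case (Suc n)
  let ?H = "\<lambda>x. poly (Hermite n) (x v) * F x" and ?K = "(create v ^^ n) K"
  have H: "polyfun_lt I (Suc (m + n)) ?H"
    by (rule polyfun_lt_mono[OF polyfun_lt_poly_mult[OF v F]]) (simp add: degree_Hermite_le)
  have "polyfun_lt I (Suc (m + n)) (\<lambda>x. ?H x - (?H x - ?K x))"
    by (intro polyfun_lt_diff H lift_Suc Suc.IH)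
  then have "polyfun_lt I (m + n) (dir_deriv (cov v) ?K)"
    using polyfun_lt_dir_deriv by fastforce
  moreover have "polyfun_lt I (Suc (m + n)) (\<lambda>x. poly (pderiv (Hermite n)) (x v) * F x)"
    by (rule polyfun_lt_mono[OF polyfun_lt_poly_mult[OF v F]])
       (use degree_Hermite_le[of n] in \<open>simp add: degree_pderiv\<close>)
  ultimately have "polyfun_lt I (Suc (m + n)) (\<lambda>x. x v * (?H x - ?K x) +
      (dir_deriv (cov v) ?K x - poly (pderiv (Hermite n)) (x v) * F x))"
    by (intro polyfun_lt.add polyfun_lt_diff polyfun_lt.times_var v Suc.IH lift_Suc[of _ _ "dir_deriv _ _"])
  then show ?case
    unfolding create_pow_Suc by (simp add: algebra_simps)
qed

lemma Hermite_prod_minus_wick: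
  assumes "set is \<subseteq> I"
  shows "polyfun_lt I (Suc (sum_list (map p is))) (\<lambda>x. \<Prod>i\<leftarrow>is. poly (Hermite (p i)) (x i)) \<and>
    polyfun_lt I (sum_list (map p is)) (\<lambda>x. (\<Prod>i\<leftarrow>is. poly (Hermite (p i)) (x i)) - wick p is x)"
  using assms
proof (induction "is")
  case Nil
  then show ?case
    by (simp add: polyfun_lt.zero polyfun_lt.const)
next
  case (Cons i "is")
  then have i: "i \<in> I" and IH: "polyfun_lt I (Suc (sum_list (map p is))) (\<lambda>x. \<Prod>i\<leftarrow>is. poly (Hermite (p i)) (x i))"
    "polyfun_lt I (sum_list (map p is)) (\<lambda>x. (\<Prod>i\<leftarrow>is. poly (Hermite (p i)) (x i)) - wick p is x)"
    by auto
  have "polyfun_lt I (Suc (sum_list (map p is) + p i)) (\<lambda>x. poly (Hermite (p i)) (x i) * (\<Prod>i\<leftarrow>is. poly (Hermite (p i)) (x i)))"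
    by (rule polyfun_lt_mono[OF polyfun_lt_poly_mult[OF i IH(1)]]) (simp add: degree_Hermite_le)
  then show ?case
    using Hermite_mult_create_pow[OF i IH, of "p i"] by (simp add: add.commute)
qed

text \<open>
  The remainder \<open>R = F - K\<close> has lower degree than the Wick product \<open>K\<close>, hence is orthogonal to it, and
  Pythagoras gives \<open>E[F^2] = E[K^2] + E[R^2]\<close>.
\<close>

lemma wick_norm_le_Hermite_norm:
  assumes "set is \<subseteq> I"
  shows "Exp (\<lambda>x. wick p is x * wick p is x) \<le> Exp (\<lambda>x. (\<Prod>i\<leftarrow>is. poly (Hermite (p i)) (x i))\<^sup>2)"
proof -
  define F where "F x = (\<Prod>i\<leftarrow>is. poly (Hermite (p i)) (x i))" for x :: "'i \<Rightarrow> real"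
  define R where "R x = F x - wick p is x" for x
  have R: "polyfun_lt I (sum_list (map p is)) R"
    using Hermite_prod_minus_wick[OF assms, of p] unfolding R_def[abs_def] F_def by blast
  note poly = polyfun_wick[OF assms, of p] polyfunI[OF R]
  have "Exp (\<lambda>x. (F x)\<^sup>2) = Exp (\<lambda>x. wick p is x * wick p is x + (2 * (wick p is x * R x) + R x * R x))"
    by (simp add: R_def power2_eq_square algebra_simps)
  also have "\<dots> = Exp (\<lambda>x. wick p is x * wick p is x) + (2 * Exp (\<lambda>x. wick p is x * R x) + Exp (\<lambda>x. R x * R x))"
    using poly by (simp add: Exp_add Exp_scale polyfun_mult polyfun_add polyfun_const)
  also have "\<dots> \<ge> Exp (\<lambda>x. wick p is x * wick p is x)"
    using wick_orthogonal[OF assms R] Exp_square_nonneg[of R] by simp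
  finally show ?thesis
    by (simp add: F_def)
qed

end

section \<open>Powers of a creation operator, and the product inequality\<close>

locale standard_gaussian_vector = centered_gaussian_vector +
  assumes unit_variance: "i \<in> I \<Longrightarrow> variance (G i) = 1"
begin

lemma cov_self: "v \<in> I \<Longrightarrow> cov v v = 1"
  using unit_variance[of v] by (simp add: cov_def Exp_def centered power2_eq_square)

text \<open>
  The canonical commutation relation \<open>D_v c_v = 1 + c_v D_v\<close>. The coefficient of the identity is
  the derivative of \<open>x_v\<close> in its own direction, that is, the variance of \<open>G_v\<close>.
\<close>

lemma dir_deriv_create:
  assumes v: "v \<in> I" and f: "polyfun I f"
  shows "dir_deriv (cov v) (create v f) = (\<lambda>x. f x + create v (dir_deriv (cov v) f) x)"
proof -
  obtain n where f: "polyfun_lt I n f"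
    using f by (auto simp: polyfun_def)
  show ?thesis
    using dir_deriv_diff[OF polyfun_lt.times_var[OF v f] polyfun_lt_dir_deriv[OF f], of "cov v" "cov v"]
    by (simp add: create_def dir_deriv_times_var[OF f] cov_self[OF v] algebra_simps)
qed

lemma dir_deriv_create_pow:
  assumes v: "v \<in> I" and f: "polyfun I f"
  shows "dir_deriv (cov v) ((create v ^^ n) f) =
    (\<lambda>x. real n * (create v ^^ (n - 1)) f x + (create v ^^ n) (dir_deriv (cov v) f) x)"
proof (induction n)
  case (Suc n)
  have shift: "(\<lambda>x. real n * create v ((create v ^^ (n - 1)) f) x) = (\<lambda>x. real n * (create v ^^ n) f x)"
    by (cases n) auto
  have "create v (dir_deriv (cov v) ((create v ^^ n) f)) =
      (\<lambda>x. real n * create v ((create v ^^ (n - 1)) f) x + (create v ^^ Suc n) (dir_deriv (cov v) f) x)"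
    unfolding Suc.IH using v f
    by (subst create_add_scale) (auto intro!: polyfun_create_pow)
  also have "\<dots> = (\<lambda>x. real n * (create v ^^ n) f x + (create v ^^ Suc n) (dir_deriv (cov v) f) x)"
    using fun_cong[OF shift] by (simp only:)
  finally show ?case
    using dir_deriv_create[OF v polyfun_create_pow[OF v f], of n]
    by (simp add: algebra_simps)
qed simp

text \<open>
  The mixed terms \<open>e_n = E[c^n f * c^(n + 1) D f]\<close> are the excess of \<open>E[(c^(n + 1) f)^2]\<close> over
  \<open>(n + 1) E[(c^n f)^2]\<close>. Moving one creation operator across and commuting gives
  \<open>e_n = n e_(n - 1) + E[(c^n D f)^2]\<close>, so they are nonnegative.
\<close>

lemma Exp_create_pow_dir_deriv_rec:
  assumes v: "v \<in> I" and f: "polyfun I f"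
  defines "b \<equiv> dir_deriv (cov v) f"
  shows "Exp (\<lambda>x. (create v ^^ n) f x * (create v ^^ Suc n) b x) =
    real n * Exp (\<lambda>x. (create v ^^ (n - 1)) f x * (create v ^^ n) b x) +
    Exp (\<lambda>x. (create v ^^ n) b x * (create v ^^ n) b x)"
proof -
  note poly = polyfun_create_pow[OF v f] polyfun_create_pow[OF v polyfun_dir_deriv[OF f], of _ "cov v", folded b_def]
  have "Exp (\<lambda>x. (create v ^^ n) f x * (create v ^^ Suc n) b x) =
      Exp (\<lambda>x. create v ((create v ^^ n) b) x * (create v ^^ n) f x)"
    by (simp add: mult.commute)
  also have "\<dots> = Exp (\<lambda>x. (create v ^^ n) b x * dir_deriv (cov v) ((create v ^^ n) f) x)"
    by (intro Exp_create_mult v poly)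
  also have "\<dots> = Exp (\<lambda>x. real n * ((create v ^^ (n - 1)) f x * (create v ^^ n) b x) +
      (create v ^^ n) b x * (create v ^^ n) b x)"
    by (simp add: dir_deriv_create_pow[OF v f] b_def algebra_simps)
  finally show ?thesis
    using poly by (simp add: Exp_add Exp_scale polyfun_mult polyfun_const)
qed

lemma Exp_create_pow_dir_deriv_nonneg:
  assumes v: "v \<in> I" and f: "polyfun I f"
  shows "Exp (\<lambda>x. (create v ^^ n) f x * (create v ^^ Suc n) (dir_deriv (cov v) f) x) \<ge> 0"
proof (induction n)
  case 0
  show ?case
    using Exp_create_pow_dir_deriv_rec[OF assms, of 0] Exp_square_nonneg by simp
next
  case (Suc n)
  show ?case
    using Exp_create_pow_dir_deriv_rec[OF assms, of "Suc n"] Suc.IH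
      Exp_square_nonneg[of "(create v ^^ Suc n) (dir_deriv (cov v) f)"]
    by (simp del: funpow.simps)
qed

lemma Exp_create_pow_Suc_square:
  assumes v: "v \<in> I" and f: "polyfun I f"
  shows "Exp (\<lambda>x. (create v ^^ Suc n) f x * (create v ^^ Suc n) f x) =
    real (Suc n) * Exp (\<lambda>x. (create v ^^ n) f x * (create v ^^ n) f x) +
    Exp (\<lambda>x. (create v ^^ n) f x * (create v ^^ Suc n) (dir_deriv (cov v) f) x)"
proof -
  let ?f = "\<lambda>n. (create v ^^ n) f" and ?b = "\<lambda>n. (create v ^^ n) (dir_deriv (cov v) f)"
  have "Exp (\<lambda>x. ?f (Suc n) x * ?f (Suc n) x) = Exp (\<lambda>x. ?f n x * dir_deriv (cov v) (?f (Suc n)) x)"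
    using Exp_create_mult[OF v, of "?f n" "?f (Suc n)"] v f by (simp add: polyfun_create polyfun_create_pow)
  also have "\<dots> = Exp (\<lambda>x. real (Suc n) * (?f n x * ?f n x) + ?f n x * ?b (Suc n) x)"
    unfolding dir_deriv_create_pow[OF v f] diff_Suc_1 by (simp only: distrib_left mult.left_commute)
  also have "\<dots> = real (Suc n) * Exp (\<lambda>x. ?f n x * ?f n x) + Exp (\<lambda>x. ?f n x * ?b (Suc n) x)"
    using v f by (subst Exp_add) (auto simp only: Exp_scale intro!: polyfun_mult polyfun_const polyfun_create_pow polyfun_dir_deriv)
  finally show ?thesis .
qed

text \<open>
  The factor \<open>n!\<close> is the least possible value of \<open>(N + 1) ... (N + n)\<close> on the spectrum of the number
  operator \<open>N\<close>. The bound holds for every polynomial \<open>f\<close>, which allows \<open>f\<close> to be a Wick product of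
  correlated coordinates.
\<close>

lemma create_pow_norm_ge:
  assumes v: "v \<in> I" and f: "polyfun I f"
  shows "fact n * Exp (\<lambda>x. f x * f x) \<le> Exp (\<lambda>x. (create v ^^ n) f x * (create v ^^ n) f x)"
proof (induction n)
  case (Suc n)
  have "fact (Suc n) * Exp (\<lambda>x. f x * f x) = real (Suc n) * (fact n * Exp (\<lambda>x. f x * f x))"
    by (simp add: mult_ac)
  also have "\<dots> \<le> real (Suc n) * Exp (\<lambda>x. (create v ^^ n) f x * (create v ^^ n) f x)"
    by (intro mult_left_mono Suc.IH) simp
  also have "\<dots> \<le> Exp (\<lambda>x. (create v ^^ Suc n) f x * (create v ^^ Suc n) f x)"
    using Exp_create_pow_Suc_square[OF assms, of n] Exp_create_pow_dir_deriv_nonneg[OF assms, of n]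
    by linarith
  finally show ?case .
qed simp

lemma wick_norm_ge:
  "set is \<subseteq> I \<Longrightarrow> (\<Prod>i\<leftarrow>is. fact (p i)) \<le> Exp (\<lambda>x. wick p is x * wick p is x)"
proof (induction "is")
  case (Cons i "is")
  have "(\<Prod>i\<leftarrow>i # is. fact (p i)) \<le> fact (p i) * Exp (\<lambda>x. wick p is x * wick p is x)"
    using Cons by (simp add: mult_left_mono)
  also have "\<dots> \<le> Exp (\<lambda>x. wick p (i # is) x * wick p (i # is) x)"
    using create_pow_norm_ge[of i "wick p is" "p i"] Cons.prems by (simp add: polyfun_wick)
  finally show ?case .
qed simp

lemma Hermite_eq_create_pow:
  assumes v: "v \<in> I"
  shows "(create v ^^ n) (\<lambda>x. 1) = (\<lambda>x. poly (Hermite n) (x v))"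
proof (induction n)
  case (Suc n)
  have "dir_deriv (cov v) (\<lambda>x. poly q (x v)) = (\<lambda>x. poly (pderiv q) (x v))" for q
  proof (rule dir_derivI)
    fix x :: "'b \<Rightarrow> real"
    have "((\<lambda>t. poly q (x v + t * cov v v)) has_real_derivative
        poly (pderiv q) (x v + 0 * cov v v) * cov v v) (at 0)"
      by (rule DERIV_chain2[OF poly_DERIV]) (auto intro!: derivative_eq_intros)
    then show "((\<lambda>t. poly q (x v + t * cov v v)) has_real_derivative poly (pderiv q) (x v)) (at 0)"
      by (simp add: cov_self[OF v])
  qed
  then show ?case
    by (simp only: create_pow_Suc Suc.IH) simp
qed simp

text \<open>
  On the constant \<open>1\<close> the derivative vanishes, so the excess over \<open>n!\<close> is zero and the lower bound for
  powers of the creation operator is an equality.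
\<close>

lemma Hermite_norm:
  assumes v: "v \<in> I"
  shows "Exp (\<lambda>x. (poly (Hermite n) (x v))\<^sup>2) = fact n"
proof -
  have "Exp (\<lambda>x. (create v ^^ n) (\<lambda>x. 1) x * (create v ^^ n) (\<lambda>x. 1) x) = fact n"
  proof (induction n)
    case (Suc n)
    then show ?case
      using Exp_create_pow_Suc_square[OF v polyfun_const, of n 1]
      by (simp only: dir_deriv_const create_pow_zero) simp
  qed simp
  then show ?thesis
    by (simp add: Hermite_eq_create_pow[OF v] power2_eq_square)
qed

theorem Hermite_product_inequality:
  "(\<Prod>i\<in>I. Exp (\<lambda>x. (poly (Hermite (p i)) (x i))\<^sup>2)) \<le>
    Exp (\<lambda>x. \<Prod>i\<in>I. (poly (Hermite (p i)) (x i))\<^sup>2)"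
proof -
  obtain "is" where "is": "set is = I" "distinct is"
    using finite_distinct_list[OF finite_I] by blast
  have prod: "(\<Prod>i\<leftarrow>is. h i) = (\<Prod>i\<in>I. h i)" for h :: "'b \<Rightarrow> real"
    using "is" by (metis prod.distinct_set_conv_list)
  have "(\<Prod>i\<in>I. Exp (\<lambda>x. (poly (Hermite (p i)) (x i))\<^sup>2)) = (\<Prod>i\<leftarrow>is. fact (p i))"
    unfolding prod by (rule prod.cong) (simp_all add: Hermite_norm)
  also have "\<dots> \<le> Exp (\<lambda>x. wick p is x * wick p is x)"
    using "is" by (intro wick_norm_ge) simp
  also have "\<dots> \<le> Exp (\<lambda>x. (\<Prod>i\<leftarrow>is. poly (Hermite (p i)) (x i))\<^sup>2)"
    using "is" by (intro wick_norm_le_Hermite_norm) simp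
  finally show ?thesis
    by (simp add: prod prod_power_distrib)
qed

end

theorem theorem1p2:
  fixes M :: "'a measure" and d :: nat
    and G :: "nat \<Rightarrow> 'a \<Rightarrow> real" and p :: "nat \<Rightarrow> nat"
  assumes "prob_space M"
    and "d \<ge> 2"
    and "gaussian_vector M {1..d} G"
    and "\<And>i. i \<in> {1..d} \<Longrightarrow> prob_space.expectation M (G i) = 0"
    and "\<And>i. i \<in> {1..d} \<Longrightarrow> prob_space.variance M (G i) = 1"
    and "\<And>i. i \<in> {1..d} \<Longrightarrow> p i \<ge> 1"
  shows "prob_space.expectation M (\<lambda>\<omega>. \<Prod>i\<in>{1..d}. (poly (Hermite (p i)) (G i \<omega>))\<^sup>2)
       \<ge> (\<Prod>i\<in>{1..d}. prob_space.expectation M (\<lambda>\<omega>. (poly (Hermite (p i)) (G i \<omega>))\<^sup>2))"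
proof -
  interpret prob_space M by fact
  interpret standard_gaussian_vector M "{1..d}" G
    by unfold_locales (use assms in auto)
  show ?thesis
    using Hermite_product_inequality[of p] by (simp add: Exp_def)
qed

end
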